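(* There exists a hyperdark ceer all of whose equivalence classes are finite.
   Context: A ceer is a computably enumerable equivalence relation on $\omega$; it is infinite if it has infinitely many equivalence classes. A transversal of an equivalence relation $R$ is a set $T\subseteq\omega$ whose distinct elements are pairwise $R$-inequivalent. A strong disjoint array is a sequence $(D_{f(n)})_{n\in\omega}$ of pairwise disjoint finite sets given by canonical indices, with $f$ computable; an infinite set is hyperimmune if no strong disjoint array has every member meeting it. A ceer is hyperdark if it is infinite and all of its infinite transversals are hyperimmune. *)

theory Defs
  imports Main "HOL-Library.Nat_Bijection"
begin

text \<open>
  Kleene's partial recursive functions. Terms carry no explicit arities: once the number of
  arguments is fixed, the arity of every subterm is determined, and a subterm used at an arity
  that does not fit it has no value there.
\<close>

datatype recfun =
    Zero
  | Succ
  | Proj nat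
  | Comp recfun "recfun list"
  | PrimRec recfun recfun
  | Mu recfun

inductive evaluates :: "recfun \<Rightarrow> nat list \<Rightarrow> nat \<Rightarrow> bool" where
  Zero: "evaluates Zero xs 0"
| Succ: "evaluates Succ [x] (Suc x)"
| Proj: "i < length xs \<Longrightarrow> evaluates (Proj i) xs (xs ! i)"
| Comp: "list_all2 (\<lambda>g y. evaluates g xs y) gs ys \<Longrightarrow> evaluates f ys z
    \<Longrightarrow> evaluates (Comp f gs) xs z"
| PrimRec_0: "evaluates f xs z \<Longrightarrow> evaluates (PrimRec f g) (0 # xs) z"
| PrimRec_Suc: "evaluates (PrimRec f g) (n # xs) y \<Longrightarrow> evaluates g (n # y # xs) z
    \<Longrightarrow> evaluates (PrimRec f g) (Suc n # xs) z"
| Mu: "evaluates f (n # xs) 0 \<Longrightarrow> \<forall>m<n. \<exists>y. evaluates f (m # xs) (Suc y)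
    \<Longrightarrow> evaluates (Mu f) xs n"

inductive_cases evaluates_ZeroE: "evaluates Zero xs z"
inductive_cases evaluates_SuccE: "evaluates Succ xs z"
inductive_cases evaluates_ProjE: "evaluates (Proj i) xs z"
inductive_cases evaluates_CompE: "evaluates (Comp f gs) xs z"
inductive_cases evaluates_PrimRec_0E: "evaluates (PrimRec f g) (0 # xs) z"
inductive_cases evaluates_PrimRec_SucE: "evaluates (PrimRec f g) (Suc n # xs) z"
inductive_cases evaluates_MuE: "evaluates (Mu f) xs z"

lemma evaluates_functional: "evaluates t xs y \<Longrightarrow> evaluates t xs z \<Longrightarrow> y = z"
proof (induction arbitrary: z rule: evaluates.induct)
  case (Comp xs gs ys f v)
  from Comp.prems obtain ys' where
    ys': "list_all2 (\<lambda>g y. evaluates g xs y) gs ys'" and f: "evaluates f ys' z"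
    by (blast elim: evaluates_CompE)
  have "ys = ys'"
    using Comp.IH(1) ys' by (auto simp: list_all2_conv_all_nth intro!: nth_equalityI)
  then show ?case
    using Comp.IH(2) f by blast
next
  case (PrimRec_Suc f g n xs y v)
  from PrimRec_Suc.prems obtain y' where
    "evaluates (PrimRec f g) (n # xs) y'" and g: "evaluates g (n # y' # xs) z"
    by (blast elim: evaluates_PrimRec_SucE)
  then have "y = y'"
    using PrimRec_Suc.IH(1) by blast
  then show ?case
    using PrimRec_Suc.IH(2) g by blast
next
  case (Mu f n xs)
  from Mu.prems have z: "evaluates f (z # xs) 0"
    and less: "\<forall>m<z. \<exists>y. evaluates f (m # xs) (Suc y)"
    by (blast elim: evaluates_MuE)+
  show ?case
  proof (rule linorder_cases[of n z])
    assume "n < z"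
    then show ?thesis using less Mu.IH(1) by blast
  next
    assume "z < n"
    then show ?thesis using z Mu.IH(2) by blast
  qed
qed (blast elim: evaluates_ZeroE evaluates_SuccE evaluates_ProjE evaluates_PrimRec_0E)+

definition computable :: "(nat \<Rightarrow> nat) \<Rightarrow> bool" where
  "computable f \<longleftrightarrow> (\<exists>t. \<forall>x. evaluates t [x] (f x))"

definition computably_enumerable :: "nat set \<Rightarrow> bool" where
  "computably_enumerable A \<longleftrightarrow> A = {} \<or> (\<exists>f. computable f \<and> A = range f)"

definition ceer :: "(nat \<times> nat) set \<Rightarrow> bool" where
  "ceer R \<longleftrightarrow> equiv UNIV R \<and> computably_enumerable (prod_encode ` R)"

definition infinite_classes :: "(nat \<times> nat) set \<Rightarrow> bool" where
  "infinite_classes R \<longleftrightarrow> infinite (UNIV // R)"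

definition transversal :: "(nat \<times> nat) set \<Rightarrow> nat set \<Rightarrow> bool" where
  "transversal R T \<longleftrightarrow> (\<forall>x\<in>T. \<forall>y\<in>T. x \<noteq> y \<longrightarrow> (x, y) \<notin> R)"

text \<open>
  The finite set with canonical index \<open>u\<close> is \<^term>\<open>set_decode u\<close>: the set of positions of
  the digit 1 in the binary expansion of \<open>u\<close>.
\<close>

definition strong_disjoint_array :: "(nat \<Rightarrow> nat) \<Rightarrow> bool" where
  "strong_disjoint_array f \<longleftrightarrow> computable f \<and>
     (\<forall>m n. m \<noteq> n \<longrightarrow> set_decode (f m) \<inter> set_decode (f n) = {})"

definition hyperimmune :: "nat set \<Rightarrow> bool" where
  "hyperimmune A \<longleftrightarrow> infinite A \<and>
     \<not> (\<exists>f. strong_disjoint_array f \<and> (\<forall>n. set_decode (f n) \<inter> A \<noteq> {}))"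

definition hyperdark :: "(nat \<times> nat) set \<Rightarrow> bool" where
  "hyperdark R \<longleftrightarrow> ceer R \<and> infinite_classes R \<and>
     (\<forall>T. transversal R T \<and> infinite T \<longrightarrow> hyperimmune T)"

end

theory Submission
  imports Defs "HOL-Library.Infinite_Set"
begin

text \<open>
  Let \<open>h\<close> be a computable enumeration of a noncomputable set. Call \<open>s\<close> a true stage if \<open>h s\<close> is new
  at stage \<open>s\<close> and smaller than every value that appears for the first time later; this is the
  complement of Dekker's deficiency set. There are infinitely many true stages, and not being one
  is a c.e. property. Hence it is a ceer with finite classes to identify two numbers when no true
  stage separates them.

  Any \<open>k + 1\<close> elements of a transversal have at least \<open>k\<close> true stages between them, and \<open>h\<close> is
  strictly increasing on true stages. A strong disjoint array whose members all meet a transversal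
  would therefore give a computable bound on the stage at which a number \<open>x\<close> in the range of \<open>h\<close> must
  have been enumerated, and the range of \<open>h\<close> would be decidable.

  The noncomputable c.e. set is the diagonal set of Kleene's formalism, c.e. because derivations of
  evaluation facts can be coded by finite sets of numbers and checked by bounded search.
\<close>

section \<open>Computable functions and decidable predicates\<close>

text \<open>
  Computability is only tracked for unary functions, with several variables packed by
  \<^const>\<open>prod_encode\<close>; a bounded quantifier adds its variable as a new first component.
\<close>

named_theorems computable_intros

abbreviation pfst :: "nat \<Rightarrow> nat" where "pfst z \<equiv> fst (prod_decode z)"
abbreviation psnd :: "nat \<Rightarrow> nat" where "psnd z \<equiv> snd (prod_decode z)"

definition computable2 :: "(nat \<Rightarrow> nat \<Rightarrow> nat) \<Rightarrow> bool" where
  "computable2 F \<longleftrightarrow> (\<exists>t. \<forall>x y. evaluates t [x, y] (F x y))"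

definition decidable :: "(nat \<Rightarrow> bool) \<Rightarrow> bool" where
  "decidable P \<longleftrightarrow> computable (\<lambda>x. of_bool (P x))"

lemma evaluates_Comp1:
  "evaluates g xs y \<Longrightarrow> evaluates f [y] z \<Longrightarrow> evaluates (Comp f [g]) xs z"
  by (rule evaluates.Comp[where ys = "[y]"]) auto

lemma evaluates_Comp2:
  "evaluates g xs y \<Longrightarrow> evaluates g' xs y' \<Longrightarrow> evaluates f [y, y'] z
    \<Longrightarrow> evaluates (Comp f [g, g']) xs z"
  by (rule evaluates.Comp[where ys = "[y, y']"]) auto

lemma evaluates_Proj0: "evaluates (Proj 0) (x # xs) x"
  using evaluates.Proj[of 0 "x # xs"] by simp

lemma evaluates_Proj1: "evaluates (Proj 1) (x # y # xs) y"
  using evaluates.Proj[of 1 "x # y # xs"] by simp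

lemma evaluates_Proj2: "evaluates (Proj 2) (x # y # z # xs) z"
  using evaluates.Proj[of 2 "x # y # z # xs"] by simp

lemma evaluates_constant: "\<exists>t. \<forall>xs. evaluates t xs c"
proof (induction c)
  case 0
  show ?case by (blast intro: evaluates.Zero)
next
  case (Suc c)
  then show ?case by (blast intro: evaluates_Comp1 evaluates.Succ)
qed

lemma computable_const [computable_intros]: "computable (\<lambda>x. c)"
  using evaluates_constant[of c] unfolding computable_def by blast

lemma computable_id [computable_intros]: "computable (\<lambda>x. x)"
  unfolding computable_def by (blast intro: evaluates_Proj0)

lemma computable_compose:
  assumes "computable f" "computable g"
  shows "computable (\<lambda>x. f (g x))"
  using assms unfolding computable_def by (blast intro: evaluates_Comp1)

lemma computable_compose2:
  assumes "computable2 F" "computable g" "computable h"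
  shows "computable (\<lambda>x. F (g x) (h x))"
  using assms unfolding computable_def computable2_def by (blast intro: evaluates_Comp2)

lemma computable_Suc [computable_intros]: "computable f \<Longrightarrow> computable (\<lambda>x. Suc (f x))"
  unfolding computable_def by (blast intro: evaluates_Comp1 evaluates.Succ)

lemma computable_primrec:
  assumes "F 0 = c" "\<And>n. F (Suc n) = G n (F n)" "computable2 G"
  shows "computable F"
proof -
  obtain a where a: "\<And>xs. evaluates a xs c" using evaluates_constant by blast
  obtain g where g: "\<And>x y. evaluates g [x, y] (G x y)"
    using assms(3) unfolding computable2_def by blast
  have "evaluates (PrimRec a g) [n] (F n)" for n
    by (induction n) (auto simp: assms(1,2) intro!: evaluates.PrimRec_0 a intro: evaluates.PrimRec_Suc g)
  then show ?thesis unfolding computable_def by blast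
qed

lemma computable2_add: "computable2 (+)"
proof -
  have "evaluates (PrimRec (Proj 0) (Comp Succ [Proj 1])) [x, y] (x + y)" for x y
  proof (induction x)
    case (Suc x)
    have "evaluates (Comp Succ [Proj 1]) [x, x + y, y] (Suc x + y)"
      using evaluates.Succ[of "x + y"] by (intro evaluates_Comp1[OF evaluates_Proj1]) simp
    with Suc show ?case by (rule evaluates.PrimRec_Suc)
  qed (auto intro: evaluates.PrimRec_0 evaluates_Proj0)
  then show ?thesis unfolding computable2_def by blast
qed

lemma computable2_mult: "computable2 (*)"
proof -
  obtain a where a: "\<And>x y. evaluates a [x, y] (x + y)"
    using computable2_add unfolding computable2_def by blast
  have "evaluates (PrimRec Zero (Comp a [Proj 2, Proj 1])) [x, y] (x * y)" for x y
  proof (induction x)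
    case (Suc x)
    have "evaluates (Comp a [Proj 2, Proj 1]) [x, x * y, y] (Suc x * y)"
      by (rule evaluates_Comp2, rule evaluates_Proj2, rule evaluates_Proj1) (use a in simp)
    with Suc show ?case by (rule evaluates.PrimRec_Suc)
  qed (auto intro: evaluates.intros)
  then show ?thesis unfolding computable2_def by blast
qed

lemma computable2_diff: "computable2 (-)"
proof -
  define p where "p = PrimRec Zero (Proj 0)"
  have p: "evaluates p [x] (x - 1)" for x
    unfolding p_def
    by (induction x) (auto intro: evaluates.PrimRec_0 evaluates.PrimRec_Suc evaluates.Zero evaluates_Proj0)
  have "evaluates (PrimRec (Proj 0) (Comp p [Proj 1])) [x, y] (y - x)" for x y
  proof (induction x)
    case (Suc x)
    have "evaluates (Comp p [Proj 1]) [x, y - x, y] (y - Suc x)"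
      using p[of "y - x"] by (intro evaluates_Comp1[OF evaluates_Proj1]) simp
    with Suc show ?case by (rule evaluates.PrimRec_Suc)
  qed (auto intro: evaluates.PrimRec_0 evaluates_Proj0)
  then have "evaluates (Comp (PrimRec (Proj 0) (Comp p [Proj 1])) [Proj 1, Proj 0]) [y, x] (y - x)"
    for x y by (rule evaluates_Comp2[OF evaluates_Proj1 evaluates_Proj0])
  then show ?thesis unfolding computable2_def by blast
qed

lemmas [computable_intros] =
  computable_compose2[OF computable2_add]
  computable_compose2[OF computable2_mult]
  computable_compose2[OF computable2_diff]

lemma computable2_compose:
  assumes "computable f" "computable2 G"
  shows "computable2 (\<lambda>x y. f (G x y))"
proof -
  obtain t u where "\<And>x. evaluates t [x] (f x)" "\<And>x y. evaluates u [x, y] (G x y)"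
    using assms unfolding computable_def computable2_def by blast
  then have "evaluates (Comp t [u]) [x, y] (f (G x y))" for x y by (intro evaluates_Comp1)
  then show ?thesis unfolding computable2_def by blast
qed

lemma computable2_compose2:
  assumes "computable2 F" "computable2 G" "computable2 H"
  shows "computable2 (\<lambda>x y. F (G x y) (H x y))"
proof -
  obtain t u v where "\<And>x y. evaluates t [x, y] (F x y)"
    "\<And>x y. evaluates u [x, y] (G x y)" "\<And>x y. evaluates v [x, y] (H x y)"
    using assms unfolding computable2_def by blast
  then have "evaluates (Comp t [u, v]) [x, y] (F (G x y) (H x y))" for x y
    by (intro evaluates_Comp2)
  then show ?thesis unfolding computable2_def by blast
qed

lemma computable2_first: "computable f \<Longrightarrow> computable2 (\<lambda>x y. f x)"
  by (rule computable2_compose[where G = "\<lambda>x y. x"])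
    (auto simp: computable2_def intro: evaluates_Proj0)

lemma computable2_second: "computable f \<Longrightarrow> computable2 (\<lambda>x y. f y)"
  by (rule computable2_compose[where G = "\<lambda>x y. y"])
    (use evaluates_Proj1 in \<open>auto simp: computable2_def\<close>)

lemma computable_Least2:
  assumes "computable2 q" "\<And>x. \<exists>n. q n x = 0"
  shows "computable (\<lambda>x. LEAST n. q n x = 0)"
proof -
  obtain t where t: "\<And>x y. evaluates t [x, y] (q x y)"
    using assms(1) unfolding computable2_def by blast
  have "evaluates (Mu t) [x] (LEAST n. q n x = 0)" for x
  proof (rule evaluates.Mu)
    show "evaluates t [LEAST n. q n x = 0, x] 0"
      using t[of "LEAST n. q n x = 0" x] LeastI_ex[OF assms(2)] by simp
    show "\<forall>m<LEAST n. q n x = 0. \<exists>y. evaluates t [m, x] (Suc y)"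
      by (metis t not_less_Least not0_implies_Suc)
  qed
  then show ?thesis unfolding computable_def by blast
qed

lemma computable_triangle: "computable triangle"
proof (rule computable_primrec[where c = 0 and G = "\<lambda>n y. y + Suc n"])
  show "computable2 (\<lambda>n y. y + Suc n)"
    by (intro computable2_compose2[OF computable2_add] computable2_first computable2_second
        computable_intros)
qed simp_all

lemma computable2_prod_encode: "computable2 (\<lambda>x y. prod_encode (x, y))"
  unfolding prod_encode_def split
  by (intro computable2_compose2[OF computable2_add] computable2_add
      computable2_compose[OF computable_triangle] computable2_first computable2_second
      computable_intros)

lemmas computable_prod_encode [computable_intros] = computable_compose2[OF computable2_prod_encode]

lemma triangle_strict_mono: "m < n \<Longrightarrow> triangle m < triangle n"
  by (rule lift_Suc_mono_less) simp_all

lemma prod_decode_sum: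
  "(LEAST s. Suc w - triangle (Suc s) = 0) = pfst w + psnd w"
proof -
  obtain a b where w: "prod_decode w = (a, b)" by force
  then have "w = prod_encode (a, b)" by (metis prod_decode_inverse)
  then have eq: "w = triangle (a + b) + a" by (simp add: prod_encode_def)
  have "a + b \<le> s" if "Suc w \<le> triangle (Suc s)" for s
  proof (rule ccontr)
    assume "\<not> a + b \<le> s"
    then have "triangle (Suc s) \<le> triangle (a + b)"
      using triangle_strict_mono[of "Suc s" "a + b"] by (cases "Suc s = a + b") auto
    with that eq show False by linarith
  qed
  moreover have "Suc w \<le> triangle (Suc (a + b))" by (simp add: eq)
  ultimately have "(LEAST s. Suc w - triangle (Suc s) = 0) = a + b"
    by (intro Least_equality) auto
  with w show ?thesis by simp
qed

lemma computable_prod_decode_sum: "computable (\<lambda>w. pfst w + psnd w)"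
proof -
  have "\<exists>n. Suc w - triangle (Suc n) = 0" for w
    by (rule exI[of _ w]) simp
  then have "computable (\<lambda>w. LEAST s. Suc w - triangle (Suc s) = 0)"
    by (intro computable_Least2 computable2_compose2[OF computable2_diff] computable2_second
        computable2_first computable_intros computable_compose[OF computable_triangle])
  then show ?thesis unfolding prod_decode_sum .
qed

lemma computable_pfst_id: "computable pfst"
proof -
  have "w - triangle (pfst w + psnd w) = pfst w" for w
    using prod_decode_inverse[of w] unfolding prod_encode_def by (auto simp: case_prod_beta)
  moreover have "computable (\<lambda>w. w - triangle (pfst w + psnd w))"
    by (intro computable_intros computable_compose[OF computable_triangle]
        computable_prod_decode_sum)
  ultimately show ?thesis by simp
qed

lemma computable_psnd_id: "computable psnd"
proof -
  have "computable (\<lambda>w. (pfst w + psnd w) - pfst w)"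
    by (intro computable_compose2[OF computable2_diff] computable_prod_decode_sum
        computable_pfst_id)
  then show ?thesis by simp
qed

lemmas computable_pfst [computable_intros] = computable_compose[OF computable_pfst_id]
lemmas computable_psnd [computable_intros] = computable_compose[OF computable_psnd_id]

lemma computable2_uncurry:
  assumes "computable (\<lambda>z. F (pfst z) (psnd z))"
  shows "computable2 F"
  using computable2_compose[OF assms computable2_prod_encode] by simp

lemma computable_of_bool [computable_intros]:
  "decidable P \<Longrightarrow> computable (\<lambda>x. of_bool (P x))"
  by (simp add: decidable_def)

lemma decidable_eq_0: "computable f \<Longrightarrow> decidable (\<lambda>x. f x = 0)"
proof -
  assume "computable f"
  then have "computable (\<lambda>x. 1 - f x)" by (intro computable_intros)
  moreover have "(\<lambda>x. 1 - f x) = (\<lambda>x. of_bool (f x = 0))" by auto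
  ultimately show ?thesis unfolding decidable_def by metis
qed

lemma decidable_le [computable_intros]:
  assumes "computable f" "computable g"
  shows "decidable (\<lambda>x. f x \<le> g x)"
  using decidable_eq_0[OF computable_compose2[OF computable2_diff assms]] by simp

lemma decidable_not [computable_intros]: "decidable P \<Longrightarrow> decidable (\<lambda>x. \<not> P x)"
  using decidable_eq_0[of "\<lambda>x. of_bool (P x)"] by (simp add: decidable_def)

lemma decidable_conj [computable_intros]:
  assumes "decidable P" "decidable Q"
  shows "decidable (\<lambda>x. P x \<and> Q x)"
  using computable_compose2[OF computable2_mult, of "\<lambda>x. of_bool (P x)" "\<lambda>x. of_bool (Q x)"] assms
  by (simp add: decidable_def of_bool_conj)

lemma decidable_disj [computable_intros]:
  assumes "decidable P" "decidable Q"
  shows "decidable (\<lambda>x. P x \<or> Q x)"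
  using decidable_not[OF decidable_conj[OF decidable_not[OF assms(1)] decidable_not[OF assms(2)]]]
  by simp

lemma decidable_imp [computable_intros]:
  assumes "decidable P" "decidable Q"
  shows "decidable (\<lambda>x. P x \<longrightarrow> Q x)"
  using decidable_disj[OF decidable_not[OF assms(1)] assms(2)] by simp

lemma decidable_less [computable_intros]:
  assumes "computable f" "computable g"
  shows "decidable (\<lambda>x. f x < g x)"
  using decidable_not[OF decidable_le[OF assms(2,1)]] by (simp add: not_le)

lemma decidable_eq [computable_intros]:
  assumes "computable f" "computable g"
  shows "decidable (\<lambda>x. f x = g x)"
  unfolding order_eq_iff[of "f _"]
  by (rule decidable_conj[OF decidable_le[OF assms] decidable_le[OF assms(2,1)]])

lemma computable_Least:
  assumes "decidable (\<lambda>z. Q (pfst z) (psnd z))" "\<And>x. \<exists>n. Q n x"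
  shows "computable (\<lambda>x. LEAST n. Q n x)"
proof -
  have "computable (\<lambda>x. LEAST n. of_bool (\<not> Q n x) = (0::nat))"
    by (intro computable_Least2 computable2_uncurry computable_intros assms(1)) (simp add: assms(2))
  then show ?thesis by simp
qed

lemma decidable_Ex_less [computable_intros]:
  assumes "decidable (\<lambda>z. P (pfst z) (psnd z))" "computable b"
  shows "decidable (\<lambda>x. \<exists>i<b x. P i x)"
proof -
  let ?Q = "\<lambda>n x. b x \<le> n \<or> P n x"
  have "computable (\<lambda>x. LEAST n. ?Q n x)"
    by (intro computable_Least computable_intros assms(1) computable_compose[OF assms(2)]) auto
  then have "decidable (\<lambda>x. (LEAST n. ?Q n x) < b x)"
    by (intro computable_intros assms(2))
  moreover have "(LEAST n. ?Q n x) < b x \<longleftrightarrow> (\<exists>i<b x. P i x)" for x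
  proof
    assume less: "(LEAST n. ?Q n x) < b x"
    moreover have "?Q (LEAST n. ?Q n x) x" by (rule LeastI[of _ "b x"]) simp
    ultimately show "\<exists>i<b x. P i x" by auto
  next
    assume "\<exists>i<b x. P i x"
    then obtain i where "i < b x" "P i x" by blast
    then show "(LEAST n. ?Q n x) < b x"
      by (metis (no_types, lifting) Least_le order.strict_trans1)
  qed
  ultimately show ?thesis by simp
qed

lemma decidable_All_less [computable_intros]:
  assumes "decidable (\<lambda>z. P (pfst z) (psnd z))" "computable b"
  shows "decidable (\<lambda>x. \<forall>i<b x. P i x)"
  using decidable_not[OF decidable_Ex_less[OF decidable_not[OF assms(1)] assms(2)]] by simp

lemma computable_power2_id: "computable (\<lambda>x. 2 ^ x)"
  by (rule computable_primrec[where c = 1 and G = "\<lambda>n y. 2 * y"])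
    (auto intro!: computable2_uncurry computable_intros)

lemmas computable_power2 [computable_intros] = computable_compose[OF computable_power2_id]

lemma mem_set_decode_iff:
  "n \<in> set_decode u \<longleftrightarrow> (\<exists>q<Suc u. \<exists>r<2 ^ n. u = (2 * q + 1) * 2 ^ n + r)"
proof
  assume "n \<in> set_decode u"
  then have "odd (u div 2 ^ n)" by (simp add: set_decode_def)
  then obtain q where q: "u div 2 ^ n = 2 * q + 1" by (elim oddE)
  have "u = (2 * q + 1) * 2 ^ n + u mod 2 ^ n" using div_mult_mod_eq[of u "2 ^ n"] q by simp
  moreover have "q < Suc u" using q div_le_dividend[of u "2 ^ n"] by linarith
  ultimately show "\<exists>q<Suc u. \<exists>r<2 ^ n. u = (2 * q + 1) * 2 ^ n + r"
    by (meson mod_less_divisor zero_less_numeral zero_less_power)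
next
  assume "\<exists>q<Suc u. \<exists>r<2 ^ n. u = (2 * q + 1) * 2 ^ n + r"
  then obtain q r where r: "r < 2 ^ n" and u: "u = (2 * q + 1) * 2 ^ n + r" by blast
  have "u div 2 ^ n = (2 * q + 1) + r div 2 ^ n" unfolding u by (rule div_mult_self3) simp
  then have "u div 2 ^ n = 2 * q + 1" using r by simp
  then show "n \<in> set_decode u" by (simp add: set_decode_def)
qed

lemma decidable_mem_set_decode [computable_intros]:
  assumes "computable f" "computable g"
  shows "decidable (\<lambda>x. f x \<in> set_decode (g x))"
  unfolding mem_set_decode_iff
  by (intro computable_intros computable_compose[OF assms(1)] computable_compose[OF assms(2)] assms)

lemma less_of_mem_set_decode: "n \<in> set_decode u \<Longrightarrow> n < u"
proof -
  assume "n \<in> set_decode u"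
  then obtain q r where "u = (2 * q + 1) * 2 ^ n + r" by (auto simp: mem_set_decode_iff)
  then have "2 ^ n \<le> u" by simp
  then show "n < u" using less_exp[of n] by linarith
qed

lemma decidable_finite: "finite A \<Longrightarrow> decidable (\<lambda>x. x \<in> A)"
proof (induction rule: finite_induct)
  case empty
  show ?case by (simp add: decidable_def computable_const)
next
  case (insert a A)
  have "decidable (\<lambda>x. x = a \<or> x \<in> A)" by (intro computable_intros insert.IH)
  then show ?case by simp
qed

lemma computably_enumerable_Ex:
  assumes "decidable (\<lambda>z. P (pfst z) (psnd z))"
  shows "computably_enumerable {x. \<exists>w. P x w}"
proof (cases "\<exists>x w. P x w")
  case True
  then obtain a b where ab: "P a b" by blast
  define g where
    "g z = of_bool (P (pfst z) (psnd z)) * pfst z + of_bool (\<not> P (pfst z) (psnd z)) * a" for z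
  have "computable g"
    unfolding g_def by (intro computable_intros assms)
  moreover have "{x. \<exists>w. P x w} = range g"
  proof (intro equalityI subsetI)
    fix x assume "x \<in> {x. \<exists>w. P x w}"
    then obtain w where "P x w" by blast
    then have "x = g (prod_encode (x, w))" by (simp add: g_def)
    then show "x \<in> range g" by blast
  next
    fix x assume "x \<in> range g"
    then obtain z where "x = g z" by blast
    then show "x \<in> {x. \<exists>w. P x w}"
      using ab by (cases "P (pfst z) (psnd z)") (auto simp: g_def)
  qed
  ultimately show ?thesis unfolding computably_enumerable_def by blast
next
  case False
  then show ?thesis by (auto simp: computably_enumerable_def)
qed


section \<open>Derivations of evaluation facts\<close>

primrec code :: "recfun \<Rightarrow> nat" where
  "code Zero = prod_encode (0, 0)"
| "code Succ = prod_encode (1, 0)"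
| "code (Proj i) = prod_encode (2, i)"
| "code (Comp f gs) = prod_encode (3, prod_encode (code f, list_encode (map code gs)))"
| "code (PrimRec f g) = prod_encode (4, prod_encode (code f, code g))"
| "code (Mu f) = prod_encode (5, code f)"

abbreviation fact_code :: "nat \<Rightarrow> nat \<Rightarrow> nat \<Rightarrow> nat" where
  "fact_code c x y \<equiv> prod_encode (c, prod_encode (x, y))"

text \<open>
  Besides the codes of terms, whose tags are 0 to 5, a tag 6 is used for the simultaneous
  evaluation of a list of terms.
\<close>

definition justified :: "nat set \<Rightarrow> nat \<Rightarrow> nat \<Rightarrow> nat \<Rightarrow> bool" where
  "justified A c x y \<longleftrightarrow>
     pfst c = 0 \<and> y = 0
   \<or> pfst c = 1 \<and> y \<noteq> 0 \<and> x = Suc (prod_encode (y - 1, 0))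
   \<or> pfst c = 2 \<and> x \<noteq> 0 \<and> psnd c = 0 \<and> y = pfst (x - 1)
   \<or> pfst c = 2 \<and> x \<noteq> 0 \<and> psnd c \<noteq> 0 \<and>
       fact_code (prod_encode (2, psnd c - 1)) (psnd (x - 1)) y \<in> A
   \<or> pfst c = 3 \<and>
       (\<exists>v. fact_code (prod_encode (6, psnd (psnd c))) x v \<in> A \<and> fact_code (pfst (psnd c)) v y \<in> A)
   \<or> pfst c = 4 \<and> x \<noteq> 0 \<and> pfst (x - 1) = 0 \<and> fact_code (pfst (psnd c)) (psnd (x - 1)) y \<in> A
   \<or> pfst c = 4 \<and> x \<noteq> 0 \<and> pfst (x - 1) \<noteq> 0 \<and>
       (\<exists>v. fact_code c (Suc (prod_encode (pfst (x - 1) - 1, psnd (x - 1)))) v \<in> A \<and>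
          fact_code (psnd (psnd c))
            (Suc (prod_encode (pfst (x - 1) - 1, Suc (prod_encode (v, psnd (x - 1)))))) y \<in> A)
   \<or> pfst c = 5 \<and> fact_code (psnd c) (Suc (prod_encode (y, x))) 0 \<in> A \<and>
       (\<forall>m<y. \<exists>v. fact_code (psnd c) (Suc (prod_encode (m, x))) (Suc v) \<in> A)
   \<or> pfst c = 6 \<and> psnd c = 0 \<and> y = 0
   \<or> pfst c = 6 \<and> psnd c \<noteq> 0 \<and> y \<noteq> 0 \<and>
       fact_code (pfst (psnd c - 1)) x (pfst (y - 1)) \<in> A \<and>
       fact_code (prod_encode (6, psnd (psnd c - 1))) x (psnd (y - 1)) \<in> A"

text \<open>
  A derivation is a finite set of pairs of a step number and a fact, each fact being justified by
  facts with smaller step numbers.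
\<close>

definition facts_before :: "nat \<Rightarrow> nat \<Rightarrow> nat set" where
  "facts_before w i = {k. \<exists>j<i. prod_encode (j, k) \<in> set_decode w}"

definition derivation :: "nat \<Rightarrow> bool" where
  "derivation w \<longleftrightarrow> (\<forall>p\<in>set_decode w.
     justified (facts_before w (pfst p)) (pfst (psnd p)) (pfst (psnd (psnd p))) (psnd (psnd (psnd p))))"

definition derivable :: "nat \<Rightarrow> bool" where
  "derivable k \<longleftrightarrow> (\<exists>w i. derivation w \<and> prod_encode (i, k) \<in> set_decode w)"

lemma justified_mono:
  assumes "justified A c x y" "A \<subseteq> B"
  shows "justified B c x y"
  using assms(1) unfolding justified_def
  by (elim disj_forward conj_forward ex_forward all_forward imp_forward)
    (assumption | erule subsetD[OF assms(2)])+

lemma derivable_justified: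
  assumes "finite A" "\<And>k. k \<in> A \<Longrightarrow> derivable k" "justified A c x y"
  shows "derivable (fact_code c x y)"
proof -
  obtain W I where WI: "\<And>k. k \<in> A \<Longrightarrow> derivation (W k) \<and> prod_encode (I k, k) \<in> set_decode (W k)"
    using assms(2) unfolding derivable_def by metis
  define N where "N = Suc (\<Sum>k\<in>A. I k)"
  define D where "D = (\<Union>k\<in>A. set_decode (W k)) \<union> {prod_encode (N, fact_code c x y)}"
  have "finite D" unfolding D_def using assms(1) by simp
  then have D: "set_decode (set_encode D) = D" by (rule set_encode_inverse)
  have before: "A \<subseteq> facts_before (set_encode D) N"
  proof
    fix k assume k: "k \<in> A"
    then have "I k < N" unfolding N_def using assms(1) by (simp add: member_le_sum less_Suc_eq_le)
    moreover have "prod_encode (I k, k) \<in> D" unfolding D_def using WI k by blast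
    ultimately show "k \<in> facts_before (set_encode D) N" unfolding facts_before_def D by blast
  qed
  have "derivation (set_encode D)"
    unfolding derivation_def D
  proof
    fix p assume "p \<in> D"
    then consider k where "k \<in> A" "p \<in> set_decode (W k)" | "p = prod_encode (N, fact_code c x y)"
      unfolding D_def by blast
    then show "justified (facts_before (set_encode D) (pfst p)) (pfst (psnd p))
      (pfst (psnd (psnd p))) (psnd (psnd (psnd p)))"
    proof cases
      case 1
      then have "facts_before (W k) (pfst p) \<subseteq> facts_before (set_encode D) (pfst p)"
        unfolding facts_before_def D unfolding D_def by blast
      with 1 WI show ?thesis unfolding derivation_def by (blast intro: justified_mono)
    next
      case 2
      then show ?thesis using justified_mono[OF assms(3) before] by simp
    qed
  qed
  moreover have "prod_encode (N, fact_code c x y) \<in> set_decode (set_encode D)"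
    unfolding D by (simp add: D_def)
  ultimately show ?thesis unfolding derivable_def by blast
qed

lemma derivable_induct:
  assumes "derivable (fact_code c x y)"
    and step: "\<And>A c x y. (\<And>c x y. fact_code c x y \<in> A \<Longrightarrow> P c x y) \<Longrightarrow> justified A c x y \<Longrightarrow> P c x y"
  shows "P c x y"
proof -
  obtain w i where w: "derivation w" and i: "prod_encode (i, fact_code c x y) \<in> set_decode w"
    using assms(1) unfolding derivable_def by blast
  from i show ?thesis
  proof (induction i arbitrary: c x y rule: less_induct)
    case (less i)
    have "justified (facts_before w i) c x y"
      using w less.prems unfolding derivation_def by fastforce
    then show ?case
      using step[of "facts_before w i"] less.IH unfolding facts_before_def by blast
  qed
qed

lemma derivable_Proj:
  "i < length xs \<Longrightarrow> derivable (fact_code (code (Proj i)) (list_encode xs) (xs ! i))"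
proof (induction i arbitrary: xs)
  case 0
  then obtain a l where "xs = a # l" by (cases xs) auto
  then show ?case by (intro derivable_justified[of "{}"]) (auto simp: justified_def)
next
  case (Suc i)
  then obtain a l where xs: "xs = a # l" and "i < length l" by (cases xs) auto
  then show ?case
    using Suc.IH[of l]
    by (intro derivable_justified[of "{fact_code (code (Proj i)) (list_encode l) (l ! i)}"])
      (auto simp: justified_def)
qed

lemma derivable_list:
  "list_all2 (\<lambda>g y. derivable (fact_code (code g) x y)) gs ys
    \<Longrightarrow> derivable (fact_code (prod_encode (6, list_encode (map code gs))) x (list_encode ys))"
proof (induction rule: list_all2_induct)
  case Nil
  show ?case by (intro derivable_justified[of "{}"]) (auto simp: justified_def)
next
  case (Cons g gs y ys)
  then show ?case
    by (intro derivable_justified[of "{fact_code (code g) x y,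
        fact_code (prod_encode (6, list_encode (map code gs))) x (list_encode ys)}"])
      (auto simp: justified_def)
qed

lemma derivable_if_evaluates:
  "evaluates t xs y \<Longrightarrow> derivable (fact_code (code t) (list_encode xs) y)"
proof (induction rule: evaluates.induct)
  case (Zero xs)
  show ?case by (intro derivable_justified[of "{}"]) (auto simp: justified_def)
next
  case (Succ x)
  show ?case by (intro derivable_justified[of "{}"]) (auto simp: justified_def)
next
  case (Proj i xs)
  then show ?case by (rule derivable_Proj)
next
  case (Comp xs gs ys f z)
  have "derivable (fact_code (prod_encode (6, list_encode (map code gs))) (list_encode xs) (list_encode ys))"
    by (rule derivable_list, rule list_all2_mono[OF Comp.IH(1)]) blast
  with Comp.IH(2) show ?case
    by (intro derivable_justified[of "{fact_code (code f) (list_encode ys) z,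
        fact_code (prod_encode (6, list_encode (map code gs))) (list_encode xs) (list_encode ys)}"])
      (auto simp: justified_def)
next
  case (PrimRec_0 f xs z g)
  then show ?case
    by (intro derivable_justified[of "{fact_code (code f) (list_encode xs) z}"])
      (auto simp: justified_def)
next
  case (PrimRec_Suc f g n xs y z)
  then show ?case
    by (intro derivable_justified[of "{fact_code (code (PrimRec f g)) (list_encode (n # xs)) y,
        fact_code (code g) (list_encode (n # y # xs)) z}"])
      (auto simp: justified_def)
next
  case (Mu f n xs)
  then obtain Y where Y: "\<And>m. m < n \<Longrightarrow> derivable (fact_code (code f) (list_encode (m # xs)) (Suc (Y m)))"
    by metis
  then show ?case
    using Mu.IH(1)
    by (intro derivable_justified[of "insert (fact_code (code f) (list_encode (n # xs)) 0)
        ((\<lambda>m. fact_code (code f) (list_encode (m # xs)) (Suc (Y m))) ` {..<n})"])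
      (auto simp: justified_def)
qed

lemma evaluates_if_derivable_aux:
  assumes "derivable (fact_code c x y)"
  shows "(\<forall>t xs. c = code t \<longrightarrow> x = list_encode xs \<longrightarrow> evaluates t xs y) \<and>
    (\<forall>gs xs. c = prod_encode (6, list_encode (map code gs)) \<longrightarrow> x = list_encode xs \<longrightarrow>
      (\<exists>ys. y = list_encode ys \<and> list_all2 (\<lambda>g. evaluates g xs) gs ys))"
  using assms
proof (rule derivable_induct, intro conjI allI impI)
  fix A c x y t xs
  assume IH: "\<And>c x y. fact_code c x y \<in> A \<Longrightarrow>
      (\<forall>t xs. c = code t \<longrightarrow> x = list_encode xs \<longrightarrow> evaluates t xs y) \<and>
      (\<forall>gs xs. c = prod_encode (6, list_encode (map code gs)) \<longrightarrow> x = list_encode xs \<longrightarrow>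
        (\<exists>ys. y = list_encode ys \<and> list_all2 (\<lambda>g. evaluates g xs) gs ys))"
    and J: "justified A c x y" and c: "c = code t" and x: "x = list_encode xs"
  have ev: "evaluates u zs v" if "fact_code (code u) (list_encode zs) v \<in> A" for u zs v
    using IH[OF that] by blast
  show "evaluates t xs y"
  proof (cases t)
    case Zero
    then show ?thesis using J c by (auto simp: justified_def intro: evaluates.Zero)
  next
    case Succ
    then have "y \<noteq> 0" "list_encode xs = list_encode [y - 1]"
      using J c x by (auto simp: justified_def)
    then have "xs = [y - 1]" by (simp only: list_encode_eq)
    then show ?thesis using Succ \<open>y \<noteq> 0\<close> evaluates.Succ[of "y - 1"] by simp
  next
    case (Proj i)
    have "xs \<noteq> []" using J c x Proj by (auto simp: justified_def)
    then obtain a l where xs: "xs = a # l" by (cases xs) auto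
    show ?thesis
    proof (cases i)
      case 0
      then have "y = a" using J c x Proj xs by (auto simp: justified_def)
      then show ?thesis using 0 Proj xs evaluates_Proj0 by simp
    next
      case (Suc j)
      then have "fact_code (code (recfun.Proj j)) (list_encode l) y \<in> A"
        using J c x Proj xs by (auto simp: justified_def)
      then have "evaluates (recfun.Proj j) l y" by (rule ev)
      then show ?thesis
        using Suc Proj xs evaluates.Proj[of i xs] by (auto elim: evaluates_ProjE)
    qed
  next
    case (Comp f gs)
    then obtain v where 1: "fact_code (prod_encode (6, list_encode (map code gs))) x v \<in> A"
      and 2: "fact_code (code f) v y \<in> A"
      using J c by (auto simp: justified_def)
    obtain ys where v: "v = list_encode ys" and ys: "list_all2 (\<lambda>g. evaluates g xs) gs ys"
      using IH[OF 1] x by blast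
    show ?thesis using evaluates.Comp[OF ys ev[OF 2[unfolded v]]] Comp by simp
  next
    case (PrimRec f g)
    have "xs \<noteq> []" using J c x PrimRec by (auto simp: justified_def)
    then obtain a l where xs: "xs = a # l" by (cases xs) auto
    show ?thesis
    proof (cases a)
      case 0
      then have "fact_code (code f) (list_encode l) y \<in> A"
        using J c x PrimRec xs by (auto simp: justified_def)
      then show ?thesis using 0 PrimRec xs by (auto intro: evaluates.PrimRec_0 ev)
    next
      case (Suc n)
      then obtain v where 1: "fact_code (code t) (list_encode (n # l)) v \<in> A"
        and 2: "fact_code (code g) (list_encode (n # v # l)) y \<in> A"
        using J c x PrimRec xs by (auto simp: justified_def)
      then show ?thesis
        using evaluates.PrimRec_Suc[OF ev[OF 1, unfolded PrimRec] ev[OF 2]] Suc PrimRec xs by simp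
    qed
  next
    case (Mu f)
    then have 1: "fact_code (code f) (list_encode (y # xs)) 0 \<in> A"
      and 2: "\<forall>m<y. \<exists>v. fact_code (code f) (list_encode (m # xs)) (Suc v) \<in> A"
      using J c x by (auto simp: justified_def)
    show ?thesis unfolding Mu
    proof (rule evaluates.Mu[OF ev[OF 1]], intro allI impI)
      fix m assume "m < y"
      then obtain v where "fact_code (code f) (list_encode (m # xs)) (Suc v) \<in> A" using 2 by blast
      then show "\<exists>v. evaluates f (m # xs) (Suc v)" using ev by blast
    qed
  qed
next
  fix A c x y gs xs
  assume IH: "\<And>c x y. fact_code c x y \<in> A \<Longrightarrow>
      (\<forall>t xs. c = code t \<longrightarrow> x = list_encode xs \<longrightarrow> evaluates t xs y) \<and>
      (\<forall>gs xs. c = prod_encode (6, list_encode (map code gs)) \<longrightarrow> x = list_encode xs \<longrightarrow>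
        (\<exists>ys. y = list_encode ys \<and> list_all2 (\<lambda>g. evaluates g xs) gs ys))"
    and J: "justified A c x y" and c: "c = prod_encode (6, list_encode (map code gs))"
    and x: "x = list_encode xs"
  show "\<exists>ys. y = list_encode ys \<and> list_all2 (\<lambda>g. evaluates g xs) gs ys"
  proof (cases gs)
    case Nil
    then have "y = list_encode []" using J c by (auto simp: justified_def)
    then show ?thesis using Nil by blast
  next
    case (Cons g gs')
    then have "y \<noteq> 0" and 1: "fact_code (code g) x (pfst (y - 1)) \<in> A"
      and 2: "fact_code (prod_encode (6, list_encode (map code gs'))) x (psnd (y - 1)) \<in> A"
      using J c by (auto simp: justified_def)
    obtain ys where ys: "psnd (y - 1) = list_encode ys" "list_all2 (\<lambda>g. evaluates g xs) gs' ys"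
      using IH[OF 2] x by blast
    have "y = list_encode (pfst (y - 1) # ys)"
      using \<open>y \<noteq> 0\<close> prod_decode_inverse[of "y - 1"] by (simp flip: ys(1))
    moreover have "list_all2 (\<lambda>g. evaluates g xs) gs (pfst (y - 1) # ys)"
      using IH[OF 1] x ys(2) Cons by simp
    ultimately show ?thesis by blast
  qed
qed

lemma derivable_iff_evaluates:
  "derivable (fact_code (code t) (list_encode xs) y) \<longleftrightarrow> evaluates t xs y"
proof
  assume "derivable (fact_code (code t) (list_encode xs) y)"
  from evaluates_if_derivable_aux[OF this] show "evaluates t xs y" by blast
qed (rule derivable_if_evaluates)

lemma decidable_compose: "decidable P \<Longrightarrow> computable f \<Longrightarrow> decidable (\<lambda>x. P (f x))"
  unfolding decidable_def by (rule computable_compose[of "\<lambda>x. of_bool (P x)"])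

lemma fact_before_less: "fact_code c x y \<in> facts_before w i \<Longrightarrow> y < w"
proof -
  assume "fact_code c x y \<in> facts_before w i"
  then obtain j where "prod_encode (j, fact_code c x y) < w"
    unfolding facts_before_def by (auto dest: less_of_mem_set_decode)
  then show "y < w"
    using le_prod_encode_2[of y x] le_prod_encode_2[of "prod_encode (x, y)" c]
      le_prod_encode_2[of "fact_code c x y" j] by linarith
qed

lemma Ex_fact_before:
  "(\<exists>v. fact_code c x v \<in> facts_before w i \<and> Q v) \<longleftrightarrow>
     (\<exists>v<w. fact_code c x v \<in> facts_before w i \<and> Q v)"
  by (meson fact_before_less)

lemma Ex_fact_before_Suc:
  "(\<exists>v. fact_code c x (Suc v) \<in> facts_before w i) \<longleftrightarrow>
     (\<exists>v<w. fact_code c x (Suc v) \<in> facts_before w i)"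
  by (meson fact_before_less Suc_lessD)

lemma derivation_bounded:
  "derivation w \<longleftrightarrow> (\<forall>p<w. p \<in> set_decode w \<longrightarrow>
     justified (facts_before w (pfst p)) (pfst (psnd p)) (pfst (psnd (psnd p))) (psnd (psnd (psnd p))))"
  unfolding derivation_def using less_of_mem_set_decode by blast

lemma mem_facts_before: "k \<in> facts_before w i \<longleftrightarrow> (\<exists>j<i. prod_encode (j, k) \<in> set_decode w)"
  by (simp add: facts_before_def)

lemma decidable_derivation: "decidable derivation"
  unfolding derivation_bounded justified_def
  unfolding Ex_fact_before Ex_fact_before_Suc
  unfolding mem_facts_before
  by (intro computable_intros)

section \<open>A noncomputable enumeration\<close>

definition diagonal :: "nat set" where
  "diagonal = {c. derivable (fact_code c (list_encode [c]) 0)}"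

lemma computably_enumerable_diagonal: "computably_enumerable diagonal"
proof -
  define P where "P c z \<longleftrightarrow> derivation (pfst z) \<and>
      prod_encode (psnd z, fact_code c (list_encode [c]) 0) \<in> set_decode (pfst z)" for c z
  have "c \<in> diagonal \<longleftrightarrow> (\<exists>z. P c z)" for c
  proof
    assume "c \<in> diagonal"
    then obtain w i where "P c (prod_encode (w, i))"
      unfolding diagonal_def derivable_def P_def by auto
    then show "\<exists>z. P c z" ..
  qed (auto simp: diagonal_def derivable_def P_def)
  then have "diagonal = {c. \<exists>z. P c z}" by blast
  moreover have "computably_enumerable {c. \<exists>z. P c z}"
    unfolding P_def list_encode.simps
    by (intro computably_enumerable_Ex computable_intros decidable_compose[OF decidable_derivation])
  ultimately show ?thesis by simp
qed

lemma not_decidable_diagonal: "\<not> decidable (\<lambda>x. x \<in> diagonal)"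
proof
  assume "decidable (\<lambda>x. x \<in> diagonal)"
  then obtain d where d: "\<And>x. evaluates d [x] (of_bool (x \<in> diagonal))"
    unfolding decidable_def computable_def by blast
  have "code d \<in> diagonal \<longleftrightarrow> evaluates d [code d] 0"
    unfolding diagonal_def mem_Collect_eq derivable_iff_evaluates ..
  also have "\<dots> \<longleftrightarrow> code d \<notin> diagonal"
    using d[of "code d"] evaluates_functional by (cases "code d \<in> diagonal") fastforce+
  finally show False by blast
qed

lemma ex_noncomputable_enumeration:
  "\<exists>h. computable h \<and> \<not> decidable (\<lambda>x. x \<in> range h)"
proof -
  have "diagonal \<noteq> {}" using not_decidable_diagonal decidable_finite[of "{}"] by auto
  then show ?thesis
    using computably_enumerable_diagonal not_decidable_diagonal
    unfolding computably_enumerable_def by metis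
qed

section \<open>The ceer of gaps between true stages\<close>

locale noncomputable_enumeration =
  fixes h :: "nat \<Rightarrow> nat"
  assumes computable_h: "computable h"
    and not_decidable_range: "\<not> decidable (\<lambda>x. x \<in> range h)"
begin

definition new_stage :: "nat \<Rightarrow> bool" where
  "new_stage s \<longleftrightarrow> (\<forall>i<s. h i \<noteq> h s)"

definition true_stages :: "nat set" where
  "true_stages = {s. new_stage s \<and> (\<forall>t>s. new_stage t \<longrightarrow> h s < h t)}"

definition same_gap :: "(nat \<times> nat) set" where
  "same_gap = {(x, y). \<forall>s\<in>true_stages. s \<le> x \<longleftrightarrow> s \<le> y}"

lemma infinite_range: "infinite (range h)"
  using not_decidable_range decidable_finite[of "range h"] by argo

lemma ex_new_stage: "x \<in> range h \<Longrightarrow> \<exists>s. new_stage s \<and> h s = x"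
proof -
  assume "x \<in> range h"
  then have ex: "\<exists>s. h s = x" by blast
  let ?s = "LEAST s. h s = x"
  have "h ?s = x" using ex by (rule LeastI_ex)
  moreover have "h i \<noteq> x" if "i < ?s" for i using that by (rule not_less_Least)
  ultimately show ?thesis unfolding new_stage_def by metis
qed

lemma infinite_new_stages: "infinite {s. new_stage s}"
proof
  assume fin: "finite {s. new_stage s}"
  have "range h \<subseteq> h ` {s. new_stage s}"
  proof
    fix x assume "x \<in> range h"
    then obtain s where "new_stage s" "h s = x" using ex_new_stage by blast
    then show "x \<in> h ` {s. new_stage s}" by auto
  qed
  then have "finite (range h)" using finite_imageI[OF fin] by (rule finite_subset)
  then show False using infinite_range by simp
qed

lemma infinite_true_stages: "infinite true_stages"
  unfolding infinite_nat_iff_unbounded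
proof
  fix m
  let ?P = "\<lambda>s. m < s \<and> new_stage s"
  obtain s0 where "?P s0"
    using infinite_new_stages unfolding infinite_nat_iff_unbounded by blast
  then obtain s where s: "?P s" "\<And>t. ?P t \<Longrightarrow> h s \<le> h t"
    using ex_has_least_nat[of ?P s0 h] by metis
  have "h s < h t" if "t > s" "new_stage t" for t
  proof -
    have "h s \<le> h t" using s that by simp
    moreover have "h s \<noteq> h t" using that unfolding new_stage_def by blast
    ultimately show ?thesis by simp
  qed
  with s(1) have "s \<in> true_stages" unfolding true_stages_def by simp
  with s(1) show "\<exists>n>m. n \<in> true_stages" by blast
qed

lemma equiv_same_gap: "equiv UNIV same_gap"
  unfolding same_gap_def by (intro equivI) (auto simp: refl_on_def sym_def trans_def)

lemma finite_class:
  assumes "C \<in> UNIV // same_gap"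
  shows "finite C"
proof -
  obtain x where C: "C = same_gap `` {x}" using assms by (auto elim: quotientE)
  obtain s where s: "s > x" "s \<in> true_stages"
    using infinite_true_stages unfolding infinite_nat_iff_unbounded by blast
  have "y < s" if "y \<in> C" for y
  proof -
    have "s \<le> x \<longleftrightarrow> s \<le> y" using that s(2) unfolding C same_gap_def by blast
    with s(1) show ?thesis by simp
  qed
  then have "C \<subseteq> {..<s}" by blast
  then show ?thesis by (rule finite_subset) simp
qed

lemma infinite_classes_same_gap: "infinite_classes same_gap"
  unfolding infinite_classes_def
proof
  assume "finite (UNIV // same_gap)"
  then have "finite (\<Union> (UNIV // same_gap))" using finite_class by blast
  then show False by (simp add: Union_quotient[OF equiv_same_gap])
qed

lemma decidable_new_stage: "decidable new_stage"
  unfolding new_stage_def by (intro computable_intros computable_compose[OF computable_h])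

definition refutes :: "nat \<Rightarrow> nat \<Rightarrow> bool" where
  "refutes t s \<longleftrightarrow> \<not> new_stage s \<or> s < t \<and> new_stage t \<and> h t \<le> h s"

lemma not_true_stage_iff: "s \<notin> true_stages \<longleftrightarrow> (\<exists>t. refutes t s)"
  unfolding true_stages_def refutes_def by (auto simp: not_less)

lemma same_gap_iff:
  "(x, y) \<in> same_gap \<longleftrightarrow>
    (\<exists>w. \<forall>s<Suc (x + y). \<not> (s \<le> x \<longrightarrow> s \<le> y) \<or> \<not> (s \<le> y \<longrightarrow> s \<le> x) \<longrightarrow> (\<exists>t<w. refutes t s))"
  (is "_ \<longleftrightarrow> (\<exists>w. \<forall>s<_. ?B s \<longrightarrow> _)")
proof
  assume xy: "(x, y) \<in> same_gap"
  have "\<exists>t. ?B s \<longrightarrow> refutes t s" for s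
    using xy not_true_stage_iff[of s] unfolding same_gap_def by blast
  then obtain \<tau> where \<tau>: "\<And>s. ?B s \<Longrightarrow> refutes (\<tau> s) s" by metis
  have "\<tau> s < Suc (\<Sum>s<Suc (x + y). \<tau> s)" if "s < Suc (x + y)" for s
    using that member_le_sum[of s "{..<Suc (x + y)}" \<tau>] by (simp add: less_Suc_eq_le)
  then show "\<exists>w. \<forall>s<Suc (x + y). ?B s \<longrightarrow> (\<exists>t<w. refutes t s)" using \<tau> by blast
next
  assume "\<exists>w. \<forall>s<Suc (x + y). ?B s \<longrightarrow> (\<exists>t<w. refutes t s)"
  then have "s \<notin> true_stages" if "?B s" for s
    using that not_true_stage_iff by (metis le_add1 le_add2 le_trans less_Suc_eq_le)
  then show "(x, y) \<in> same_gap" unfolding same_gap_def by blast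
qed

lemma ceer_same_gap: "ceer same_gap"
proof -
  have "prod_encode ` same_gap = {p. (pfst p, psnd p) \<in> same_gap}"
    by (auto simp: image_iff) (metis prod_decode_inverse)
  moreover have "computably_enumerable \<dots>"
    unfolding same_gap_iff refutes_def
    by (intro computably_enumerable_Ex computable_intros decidable_compose[OF decidable_new_stage]
        computable_compose[OF computable_h])
  ultimately show ?thesis using equiv_same_gap unfolding ceer_def by simp
qed

lemma mem_range_iff_bounded:
  assumes "x < card (true_stages \<inter> {..b})"
  shows "x \<in> range h \<longleftrightarrow> (\<exists>i<Suc b. h i = x)"
proof
  have inj: "inj_on h (true_stages \<inter> {..b})"
    by (rule linorder_inj_onI) (auto simp: true_stages_def)
  have "\<not> h ` (true_stages \<inter> {..b}) \<subseteq> {..<x}"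
    using assms card_image[OF inj] card_mono[of "{..<x}" "h ` (true_stages \<inter> {..b})"] by auto
  then obtain s where s: "s \<in> true_stages" "s \<le> b" "x \<le> h s"
    by (meson IntE atMost_iff image_subsetI lessThan_iff not_le)
  assume "x \<in> range h"
  then obtain t where t: "new_stage t" "h t = x" using ex_new_stage by blast
  have "t \<le> s"
  proof (rule ccontr)
    assume "\<not> t \<le> s"
    then have "h s < h t" using s(1) t(1) unfolding true_stages_def by simp
    then show False using s(3) t(2) by simp
  qed
  then have "t < Suc b" using s(2) by simp
  with t(2) show "\<exists>i<Suc b. h i = x" by blast
qed auto

lemma card_transversal_le:
  assumes "transversal same_gap T" "A \<subseteq> T" "A \<subseteq> {..b}"
  shows "card A \<le> Suc (card (true_stages \<inter> {..b}))"
proof -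
  let ?c = "\<lambda>a. card (true_stages \<inter> {..a})"
  have less: "?c x < ?c y" if "x \<in> A" "y \<in> A" "x < y" for x y
  proof -
    have "x \<in> T" "y \<in> T" "x \<noteq> y" using that assms(2) by auto
    then have "(x, y) \<notin> same_gap" using assms(1) unfolding transversal_def by simp
    then obtain s where s: "s \<in> true_stages" "(s \<le> x) \<noteq> (s \<le> y)" unfolding same_gap_def by auto
    then have "s \<in> true_stages \<inter> {..y}" "s \<notin> true_stages \<inter> {..x}" using that(3) by auto
    moreover have "true_stages \<inter> {..x} \<subseteq> true_stages \<inter> {..y}" using that(3) by auto
    ultimately show ?thesis by (intro psubset_card_mono) auto
  qed
  have "inj_on ?c A"
  proof (rule inj_onI, rule ccontr)
    fix x y assume "x \<in> A" "y \<in> A" "?c x = ?c y" "x \<noteq> y"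
    then show False using less[of x y] less[of y x] by (cases x y rule: linorder_cases) simp_all
  qed
  moreover have "?c ` A \<subseteq> {..?c b}" using assms(3) by (auto intro!: card_mono)
  ultimately have "card A \<le> card {..?c b}" by (intro card_inj_on_le) auto
  then show ?thesis by simp
qed

lemma hyperimmune_transversal:
  assumes T: "transversal same_gap T" "infinite T"
  shows "hyperimmune T"
  unfolding hyperimmune_def
proof (rule conjI[OF T(2)], rule notI)
  assume "\<exists>f. strong_disjoint_array f \<and> (\<forall>n. set_decode (f n) \<inter> T \<noteq> {})"
  then obtain f where f: "computable f" "\<And>n. set_decode (f n) \<inter> T \<noteq> {}"
    and disj: "\<And>m n. m \<noteq> n \<Longrightarrow> set_decode (f m) \<inter> set_decode (f n) = {}"
    unfolding strong_disjoint_array_def by blast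
  have "\<forall>n. \<exists>t. t \<in> set_decode (f n) \<and> t \<in> T" using f(2) by blast
  then obtain \<tau> where \<tau>: "\<And>n. \<tau> n \<in> set_decode (f n)" "\<And>n. \<tau> n \<in> T"
    by metis
  have "inj \<tau>" using \<tau>(1) disj by (intro injI) (metis disjoint_iff)
  define b where "b x = (\<Sum>i<x. f i)" for x
  have "computable b"
    by (rule computable_primrec[where c = 0 and G = "\<lambda>n y. y + f n"])
      (auto simp: b_def intro!: computable2_uncurry computable_intros computable_compose[OF f(1)])
  have "x < card (true_stages \<inter> {..b (x + 2)})" for x
  proof -
    have "\<tau> i \<le> b (x + 2)" if "i < x + 2" for i
      using that less_of_mem_set_decode[OF \<tau>(1)[of i]] member_le_sum[of i "{..<x + 2}" f]
      unfolding b_def by simp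
    then have "card (\<tau> ` {..<x + 2}) \<le> Suc (card (true_stages \<inter> {..b (x + 2)}))"
      using \<tau>(2) by (intro card_transversal_le[OF T(1)]) auto
    moreover have "card (\<tau> ` {..<x + 2}) = x + 2"
      using card_image[OF inj_on_subset[OF \<open>inj \<tau>\<close>]] by simp
    ultimately show ?thesis by simp
  qed
  then have "x \<in> range h \<longleftrightarrow> (\<exists>i<Suc (b (x + 2)). h i = x)" for x
    by (rule mem_range_iff_bounded)
  moreover have "decidable (\<lambda>x. \<exists>i<Suc (b (x + 2)). h i = x)"
    by (intro computable_intros computable_compose[OF computable_h]
        computable_compose[OF \<open>computable b\<close>])
  ultimately show False using not_decidable_range by simp
qed

lemma hyperdark_same_gap: "hyperdark same_gap"
  by (simp add: hyperdark_def ceer_same_gap infinite_classes_same_gap hyperimmune_transversal)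

end

theorem theorem2p9:
  "\<exists>R. hyperdark R \<and> (\<forall>C \<in> UNIV // R. finite C)"
proof -
  obtain h where "computable h" "\<not> decidable (\<lambda>x. x \<in> range h)"
    using ex_noncomputable_enumeration by blast
  then interpret noncomputable_enumeration h by unfold_locales
  show ?thesis
    by (intro exI[of _ same_gap] conjI ballI hyperdark_same_gap finite_class)
qed

end
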